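(* Let $C\ge2$ and let $\pi_i^L\le\pi_i^U$, $\alpha_i^L\le\alpha_i^U$ ($i=1,\dots,C-1$) be the lower and upper bounds for cumulative probabilities described in the context. Let $$D^L=\min_{\pi,\alpha}\max_{i=1,\dots,C-1}|\pi_i-\alpha_i|,\qquad D^U=\max_{\pi,\alpha}\max_{i=1,\dots,C-1}|\pi_i-\alpha_i|,$$ where the optimization is over all cumulative distributions $\pi,\alpha$ with $\pi_i^L\le\pi_i\le\pi_i^U$ and $\alpha_i^L\le\alpha_i\le\alpha_i^U$, $i=1,\dots,C-1$. Then the lower bound $D^L$ is the optimal value of the linear programming problem $$D^L=\min_{B,\pi,\alpha}B$$ subject to $$\pi_i^L\le\pi_i\le\pi_i^U,\quad \alpha_i^L\le\alpha_i\le\alpha_i^U,\quad i=1,\dots,C-1,$$ $$B\ge\pi_i-\alpha_i,\quad B\ge\alpha_i-\pi_i,\quad i=1,\dots,C-1,$$ $$\pi_i\le\pi_{i+1},\quad\alpha_i\le\alpha_{i+1},\quad i=1,\dots,C-2,$$ and the upper bound $D^U$ is $$D^U=\max_{k=1,\dots,C-1}\max\left(\pi_k^U-\alpha_k^L,\ \alpha_k^U-\pi_k^L\right).$$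
   Context: For a probability distribution $(p_1,\dots,p_C)$ on $C$ classes, its cumulative distribution is $\pi_i=\sum_{j\le i}p_j$; cumulative distributions are nondecreasing in $i$, with last entry (index $C$) equal to $1$. The quantity $\max_{i=1,\dots,C-1}|\pi_i-\alpha_i|$ is the Kolmogorov-Smirnov distance between the two distributions. Two fixed probability distributions $P_\emptyset$ and $P_N$ on $C$ classes and a number $\varepsilon\in[0,1]$ are given. The imprecise $\varepsilon$-contamination model replaces a distribution $P$ by the set of distributions $P^*=(1-\varepsilon)P+\varepsilon H$, with $H$ an arbitrary distribution, so that the probability of an event $A$ is bounded by $(1-\varepsilon)P(A)\le P^*(A)\le(1-\varepsilon)P(A)+\varepsilon$. Taking $A=\{1,\dots,i\}$ gives bounds for the $i$-th cumulative probability. The letters $\pi$ and $\alpha$ denote cumulative distributions in the sets produced by the model from $P_\emptyset$ and $P_N$ respectively, with bounds $\pi_i^L=(1-\varepsilon)P_\emptyset(\{1,\dots,i\})$, $\pi_i^U=\pi_i^L+\varepsilon$, $\alpha_i^L=(1-\varepsilon)P_N(\{1,\dots,i\})$, $\alpha_i^U=\alpha_i^L+\varepsilon$. *)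

theory Defs
  imports "HOL-Probability.Probability"
begin

text \<open>
  The classes are the numbers 1, ..., \<open>C\<close>.  Cumulative distributions are functions
  on \<open>nat\<close> of which only the values at 1, ..., \<open>C\<close> matter.
\<close>

definition dist_on :: "nat \<Rightarrow> nat pmf \<Rightarrow> bool" where
  "dist_on C P \<longleftrightarrow> set_pmf P \<subseteq> {1..C}"

definition cumulative :: "nat \<Rightarrow> (nat \<Rightarrow> real) \<Rightarrow> bool" where
  "cumulative C \<pi> \<longleftrightarrow> (\<exists>P. dist_on C P \<and> (\<forall>i\<in>{1..C}. \<pi> i = (\<Sum>j=1..i. pmf P j)))"

definition ks_dist :: "nat \<Rightarrow> (nat \<Rightarrow> real) \<Rightarrow> (nat \<Rightarrow> real) \<Rightarrow> real" where
  "ks_dist C \<pi> \<alpha> = (MAX i\<in>{1..C-1}. \<bar>\<pi> i - \<alpha> i\<bar>)"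

definition cum_lower :: "real \<Rightarrow> nat pmf \<Rightarrow> nat \<Rightarrow> real" where
  "cum_lower \<epsilon> P i = (1 - \<epsilon>) * measure_pmf.prob P {1..i}"

definition cum_upper :: "real \<Rightarrow> nat pmf \<Rightarrow> nat \<Rightarrow> real" where
  "cum_upper \<epsilon> P i = cum_lower \<epsilon> P i + \<epsilon>"

definition within_bounds :: "nat \<Rightarrow> (nat \<Rightarrow> real) \<Rightarrow> (nat \<Rightarrow> real) \<Rightarrow> (nat \<Rightarrow> real) \<Rightarrow> bool" where
  "within_bounds C l u \<pi> \<longleftrightarrow> (\<forall>i\<in>{1..C-1}. l i \<le> \<pi> i \<and> \<pi> i \<le> u i)"

definition ks_values ::
  "nat \<Rightarrow> (nat \<Rightarrow> real) \<Rightarrow> (nat \<Rightarrow> real) \<Rightarrow> (nat \<Rightarrow> real) \<Rightarrow> (nat \<Rightarrow> real) \<Rightarrow> real set" where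
  "ks_values C \<pi>L \<pi>U \<alpha>L \<alpha>U =
     {ks_dist C \<pi> \<alpha> | \<pi> \<alpha>.
        cumulative C \<pi> \<and> within_bounds C \<pi>L \<pi>U \<pi> \<and>
        cumulative C \<alpha> \<and> within_bounds C \<alpha>L \<alpha>U \<alpha>}"

definition is_minimum :: "real set \<Rightarrow> real \<Rightarrow> bool" where
  "is_minimum S m \<longleftrightarrow> m \<in> S \<and> (\<forall>x\<in>S. m \<le> x)"

definition is_maximum :: "real set \<Rightarrow> real \<Rightarrow> bool" where
  "is_maximum S m \<longleftrightarrow> m \<in> S \<and> (\<forall>x\<in>S. x \<le> m)"

text \<open>
  The library operators \<open>Min\<close> and \<open>Max\<close> are meant for finite sets only, so the
  optimal values are defined by \<open>Inf\<close> and \<open>Sup\<close>; that they are attained has to be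
  stated separately, by \<open>is_minimum\<close> and \<open>is_maximum\<close>.
\<close>

definition D_lower ::
  "nat \<Rightarrow> (nat \<Rightarrow> real) \<Rightarrow> (nat \<Rightarrow> real) \<Rightarrow> (nat \<Rightarrow> real) \<Rightarrow> (nat \<Rightarrow> real) \<Rightarrow> real" where
  "D_lower C \<pi>L \<pi>U \<alpha>L \<alpha>U = Inf (ks_values C \<pi>L \<pi>U \<alpha>L \<alpha>U)"

definition D_upper ::
  "nat \<Rightarrow> (nat \<Rightarrow> real) \<Rightarrow> (nat \<Rightarrow> real) \<Rightarrow> (nat \<Rightarrow> real) \<Rightarrow> (nat \<Rightarrow> real) \<Rightarrow> real" where
  "D_upper C \<pi>L \<pi>U \<alpha>L \<alpha>U = Sup (ks_values C \<pi>L \<pi>U \<alpha>L \<alpha>U)"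

text \<open>
  The linear program has the variables \<open>B\<close>, \<open>\<pi> 1\<close>, ..., \<open>\<pi> (C - 1)\<close>, \<open>\<alpha> 1\<close>, ..., \<open>\<alpha> (C - 1)\<close>;
  the other values of \<open>\<pi>\<close> and \<open>\<alpha>\<close> are unconstrained and do not enter the objective \<open>B\<close>.
  In particular \<open>\<pi>\<close> and \<open>\<alpha>\<close> are not required to be cumulative distributions.
\<close>

definition lp_feasible ::
  "nat \<Rightarrow> (nat \<Rightarrow> real) \<Rightarrow> (nat \<Rightarrow> real) \<Rightarrow> (nat \<Rightarrow> real) \<Rightarrow> (nat \<Rightarrow> real) \<Rightarrow>
   real \<Rightarrow> (nat \<Rightarrow> real) \<Rightarrow> (nat \<Rightarrow> real) \<Rightarrow> bool" where
  "lp_feasible C \<pi>L \<pi>U \<alpha>L \<alpha>U B \<pi> \<alpha> \<longleftrightarrow>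
     within_bounds C \<pi>L \<pi>U \<pi> \<and> within_bounds C \<alpha>L \<alpha>U \<alpha> \<and>
     (\<forall>i\<in>{1..C-1}. B \<ge> \<pi> i - \<alpha> i \<and> B \<ge> \<alpha> i - \<pi> i) \<and>
     (\<forall>i\<in>{1..C-2}. \<pi> i \<le> \<pi> (i + 1) \<and> \<alpha> i \<le> \<alpha> (i + 1))"

definition lp_values ::
  "nat \<Rightarrow> (nat \<Rightarrow> real) \<Rightarrow> (nat \<Rightarrow> real) \<Rightarrow> (nat \<Rightarrow> real) \<Rightarrow> (nat \<Rightarrow> real) \<Rightarrow> real set" where
  "lp_values C \<pi>L \<pi>U \<alpha>L \<alpha>U = {B. \<exists>\<pi> \<alpha>. lp_feasible C \<pi>L \<pi>U \<alpha>L \<alpha>U B \<pi> \<alpha>}"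

end

theory Submission
  imports Defs
begin

text \<open>
  Both optima have explicit solutions.  For \<open>D\<^sup>L\<close> let \<open>B\<close> be the largest of \<open>0\<close> and all
  \<open>\<pi>\<^sup>L - \<alpha>\<^sup>U\<close> and \<open>\<alpha>\<^sup>L - \<pi>\<^sup>U\<close>, a lower bound for every feasible value; the pair
  \<open>max \<pi>\<^sup>L (\<alpha>\<^sup>L - B)\<close>, \<open>max \<alpha>\<^sup>L (\<pi>\<^sup>L - B)\<close> is monotone, respects the bounds and has
  distance at most \<open>B\<close>.  For \<open>D\<^sup>U\<close> one of the pairs \<open>(\<pi>\<^sup>U, \<alpha>\<^sup>L)\<close> and \<open>(\<pi>\<^sup>L, \<alpha>\<^sup>U)\<close> is optimal.
  Any monotone function with values in \<open>[0,1]\<close> becomes a cumulative distribution once its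
  value at \<open>C\<close> is set to \<open>1\<close>, which affects neither the distance nor the bounds.
\<close>

text \<open>Index \<open>C\<close> is left out so that lower envelopes qualify: for a distribution
  on the classes, \<open>cum_lower\<close> has the value \<open>1 - \<epsilon>\<close> there instead
  of 1.\<close>

definition subcumulative :: "nat \<Rightarrow> (nat \<Rightarrow> real) \<Rightarrow> bool" where
  "subcumulative C f \<longleftrightarrow> (\<forall>i\<in>{1..C-1}. 0 \<le> f i \<and> f i \<le> 1) \<and> mono_on {1..C-1} f"

text \<open>Consecutive differences of \<open>f\<close> serve as point masses: they are nonnegative
  by monotonicity and \<open>0 \<le> f 1\<close>, and they telescope to
  \<open>f C = 1\<close>.\<close>

lemma cumulativeI:
  assumes "C \<ge> 1" "0 \<le> f 1" "mono_on {1..C} f" "f C = 1"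
  shows "cumulative C f"
proof -
  \<comment> \<open>The first difference is taken against 0, since nothing is known about
    \<open>f 0\<close>.\<close>
  define g where "g j = (if j \<in> {1..C} then f j - (if j = 1 then 0 else f (j - 1)) else 0)" for j
  have g_nonneg: "0 \<le> g j" for j
    using assms by (auto simp: g_def intro!: mono_onD[OF assms(3)])
  have sum_g: "(\<Sum>j=1..i. g j) = f i" if "1 \<le> i" "i \<le> C" for i
    using that by (induction i rule: dec_induct) (auto simp: g_def)
  have "(\<integral>\<^sup>+ j. ennreal (g j) \<partial>count_space UNIV) = (\<Sum>j=1..C. ennreal (g j))"
    by (rule nn_integral_count_space') (auto simp: g_def)
  also have "\<dots> = 1"
    using sum_g[of C] assms by (simp add: sum_ennreal g_nonneg)
  finally have total: "(\<integral>\<^sup>+ j. ennreal (g j) \<partial>count_space UNIV) = 1" .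
  have pmf_g: "pmf (embed_pmf g) j = g j" for j
    using g_nonneg total by (rule pmf_embed_pmf)
  have "set_pmf (embed_pmf g) \<subseteq> {1..C}"
    by (auto simp: set_pmf_iff pmf_g g_def split: if_splits)
  then show ?thesis
    using sum_g by (auto simp: cumulative_def dist_on_def pmf_g intro!: exI[of _ "embed_pmf g"])
qed

lemma cumulative_upd_if_subcumulative:
  assumes "C \<ge> 2" "subcumulative C f"
  shows "cumulative C (f(C := 1))"
proof (rule cumulativeI)
  \<comment> \<open>Pairs ending at \<open>C\<close> are left out here; for them the bound
    \<open>f r \<le> 1\<close> suffices.\<close>
  have "f r \<le> f s" if "1 \<le> r" "r \<le> s" "s < C" for r s
    using assms that by (intro mono_onD[of "{1..C-1}" f]) (auto simp: subcumulative_def)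
  then show "mono_on {1..C} (f(C := 1))"
    using assms by (auto simp: subcumulative_def intro!: mono_onI)
qed (use assms in \<open>auto simp: subcumulative_def\<close>)

lemma within_bounds_upd: "within_bounds C l u (f(C := x)) \<longleftrightarrow> within_bounds C l u f"
  by (cases C) (auto simp: within_bounds_def)

lemma ks_dist_upd: "ks_dist C (f(C := x)) (g(C := y)) = ks_dist C f g"
proof -
  have "(\<lambda>i. \<bar>(f(C := x)) i - (g(C := y)) i\<bar>) ` {1..C-1} = (\<lambda>i. \<bar>f i - g i\<bar>) ` {1..C-1}"
    by (rule image_cong) auto
  then show ?thesis
    unfolding ks_dist_def by (rule arg_cong)
qed

lemma ks_values_subcumulative:
  assumes "C \<ge> 2" "subcumulative C f" "subcumulative C g"
    and "within_bounds C \<pi>L \<pi>U f" "within_bounds C \<alpha>L \<alpha>U g"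
  shows "ks_dist C f g \<in> ks_values C \<pi>L \<pi>U \<alpha>L \<alpha>U"
  unfolding ks_values_def mem_Collect_eq
  using assms cumulative_upd_if_subcumulative within_bounds_upd ks_dist_upd by metis

lemma ks_dist_le_iff:
  assumes "C \<ge> 2"
  shows "ks_dist C f g \<le> B \<longleftrightarrow> (\<forall>i\<in>{1..C-1}. \<bar>f i - g i\<bar> \<le> B)"
  using assms unfolding ks_dist_def by (subst Max_le_iff) auto

lemma abs_diff_le_ks_dist:
  assumes "i \<in> {1..C-1}"
  shows "\<bar>f i - g i\<bar> \<le> ks_dist C f g"
  unfolding ks_dist_def using assms by (intro Max_ge) auto

text \<open>This serves the minimizing pair. Taking the maximum with \<open>f\<close> keeps the
  values nonnegative, and \<open>0 \<le> B\<close> keeps them at most 1.\<close>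

lemma subcumulative_max:
  assumes "subcumulative C f" "subcumulative C g" "0 \<le> B"
  shows "subcumulative C (\<lambda>i. max (f i) (g i - B))"
  using assms unfolding subcumulative_def mono_on_def
  by (smt (verit, best))

lemma subcumulative_cum_lower:
  assumes "0 \<le> \<epsilon>" "\<epsilon> \<le> 1"
  shows "subcumulative C (cum_lower \<epsilon> P)"
  using assms unfolding subcumulative_def cum_lower_def
  by (auto intro!: mono_onI mult_left_mono measure_pmf.finite_measure_mono mult_le_one)

text \<open>The lower envelope never exceeds \<open>1 - \<epsilon>\<close>, so adding \<epsilon>
  stays within 1 without truncation.\<close>

lemma subcumulative_cum_upper:
  assumes "0 \<le> \<epsilon>" "\<epsilon> \<le> 1"
  shows "subcumulative C (cum_upper \<epsilon> P)"
proof -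
  have "(1 - \<epsilon>) * measure_pmf.prob P {1..i} \<le> 1 - \<epsilon>" for i
    using assms by (simp add: mult_left_le)
  then have "cum_upper \<epsilon> P i \<le> 1" for i
    by (simp add: cum_upper_def cum_lower_def algebra_simps)
  then show ?thesis
    using subcumulative_cum_lower[OF assms, of C P] assms
    by (auto simp: subcumulative_def cum_upper_def mono_on_def)
qed

lemma is_minimum_Inf:
  assumes "is_minimum S m"
  shows "Inf S = m"
  using assms unfolding is_minimum_def by (auto intro: cInf_eq_minimum)

lemma is_maximum_Sup:
  assumes "is_maximum S m"
  shows "Sup S = m"
  using assms unfolding is_maximum_def by (auto intro: cSup_eq_maximum)

text \<open>The number \<open>d i\<close> is the gap between the intervals of admissible values at
  \<open>i\<close>, and 0 if they meet. No admissible pair can be closer than this at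
  \<open>i\<close>, and one pair attains the largest gap in both problems.\<close>

lemma is_minimum_lower_bound:
  fixes \<pi>L \<pi>U \<alpha>L \<alpha>U :: "nat \<Rightarrow> real"
  defines "d i \<equiv> max 0 (max (\<pi>L i - \<alpha>U i) (\<alpha>L i - \<pi>U i))"
  assumes C: "C \<ge> 2"
    and sub: "subcumulative C \<pi>L" "subcumulative C \<alpha>L"
    and le: "\<And>i. i \<in> {1..C-1} \<Longrightarrow> \<pi>L i \<le> \<pi>U i \<and> \<alpha>L i \<le> \<alpha>U i"
  shows "is_minimum (ks_values C \<pi>L \<pi>U \<alpha>L \<alpha>U) (MAX i\<in>{1..C-1}. d i)"
    and "is_minimum (lp_values C \<pi>L \<pi>U \<alpha>L \<alpha>U) (MAX i\<in>{1..C-1}. d i)"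
proof -
  define B where "B = (MAX i\<in>{1..C-1}. d i)"
  have d_le: "d i \<le> B" if "i \<in> {1..C-1}" for i
    unfolding B_def using that by (intro Max_ge) auto
  have B_le: "B \<le> b" if "\<And>i. i \<in> {1..C-1} \<Longrightarrow> d i \<le> b" for b
    unfolding B_def using that C by (subst Max_le_iff) auto
  have B_nonneg: "0 \<le> B"
    using d_le[of 1] C by (simp add: d_def)
  \<comment> \<open>Each curve is its own lower envelope, raised only as far as needed to come
    within \<open>B\<close> of the other one. The raised value stays below the upper envelope
    because \<open>B\<close> is at least the gap.\<close>
  define \<pi> where "\<pi> i = max (\<pi>L i) (\<alpha>L i - B)" for i
  define \<alpha> where "\<alpha> i = max (\<alpha>L i) (\<pi>L i - B)" for i
  have sub': "subcumulative C \<pi>" "subcumulative C \<alpha>"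
    unfolding \<pi>_def \<alpha>_def using sub B_nonneg by (auto intro: subcumulative_max)
  have within: "within_bounds C \<pi>L \<pi>U \<pi>" "within_bounds C \<alpha>L \<alpha>U \<alpha>"
    using le d_le by (force simp: within_bounds_def \<pi>_def \<alpha>_def d_def)+
  \<comment> \<open>As \<open>B\<close> is nonnegative, at most one curve is raised at
    \<open>i\<close>, and then the difference is exactly \<open>B\<close>.\<close>
  have close: "\<bar>\<pi> i - \<alpha> i\<bar> \<le> B" for i
    using B_nonneg by (auto simp: \<pi>_def \<alpha>_def max_def)
  have ks_ge: "B \<le> x" if x: "x \<in> ks_values C \<pi>L \<pi>U \<alpha>L \<alpha>U" for x
  proof (rule B_le)
    fix i assume i: "i \<in> {1..C-1}"
    obtain f g where "x = ks_dist C f g" "within_bounds C \<pi>L \<pi>U f" "within_bounds C \<alpha>L \<alpha>U g"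
      using x by (auto simp: ks_values_def)
    then have "\<bar>f i - g i\<bar> \<le> x" "\<pi>L i \<le> f i" "f i \<le> \<pi>U i" "\<alpha>L i \<le> g i" "g i \<le> \<alpha>U i"
      using abs_diff_le_ks_dist[OF i, of f g] i by (auto simp: within_bounds_def)
    then show "d i \<le> x"
      by (simp add: d_def abs_le_iff)
  qed
  have lp_ge: "B \<le> x" if x: "x \<in> lp_values C \<pi>L \<pi>U \<alpha>L \<alpha>U" for x
  proof (rule B_le)
    fix i assume i: "i \<in> {1..C-1}"
    obtain f g where "lp_feasible C \<pi>L \<pi>U \<alpha>L \<alpha>U x f g"
      using x by (auto simp: lp_values_def)
    then have "f i - g i \<le> x" "g i - f i \<le> x"
      and "\<pi>L i \<le> f i" "f i \<le> \<pi>U i" "\<alpha>L i \<le> g i" "g i \<le> \<alpha>U i"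
      using i by (auto simp: lp_feasible_def within_bounds_def)
    \<comment> \<open>The term 0 in \<open>d i\<close> is covered because the two difference
      constraints add up to \<open>0 \<le> 2 * x\<close>.\<close>
    then show "d i \<le> x"
      by (simp add: d_def)
  qed
  have ks_mem: "ks_dist C \<pi> \<alpha> \<in> ks_values C \<pi>L \<pi>U \<alpha>L \<alpha>U"
    using C sub' within by (rule ks_values_subcumulative)
  moreover have "ks_dist C \<pi> \<alpha> = B"
    using ks_ge[OF ks_mem] close ks_dist_le_iff[OF C, of \<pi> \<alpha> B] by auto
  ultimately show "is_minimum (ks_values C \<pi>L \<pi>U \<alpha>L \<alpha>U) (MAX i\<in>{1..C-1}. d i)"
    using ks_ge by (simp add: is_minimum_def B_def)
  have "lp_feasible C \<pi>L \<pi>U \<alpha>L \<alpha>U B \<pi> \<alpha>"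
    unfolding lp_feasible_def
  proof (intro conjI ballI within)
    fix i assume "i \<in> {1..C-2}"
    then have "i \<in> {1..C-1}" "i + 1 \<in> {1..C-1}"
      by auto
    then show "\<pi> i \<le> \<pi> (i + 1)" "\<alpha> i \<le> \<alpha> (i + 1)"
      using sub' by (simp_all add: subcumulative_def mono_on_def)
  qed (use close in \<open>auto simp: abs_le_iff\<close>)
  then show "is_minimum (lp_values C \<pi>L \<pi>U \<alpha>L \<alpha>U) (MAX i\<in>{1..C-1}. d i)"
    using lp_ge by (auto simp: is_minimum_def lp_values_def B_def)
qed

text \<open>Two points of two intervals are farthest apart at opposite endpoints, at distance
  \<open>d i\<close>. The envelopes are themselves admissible up to the value at \<open>C\<close>,
  so these endpoints can be reached.\<close>

lemma is_maximum_upper_bound: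
  fixes \<pi>L \<pi>U \<alpha>L \<alpha>U :: "nat \<Rightarrow> real"
  defines "d i \<equiv> max (\<pi>U i - \<alpha>L i) (\<alpha>U i - \<pi>L i)"
  assumes C: "C \<ge> 2"
    and sub: "subcumulative C \<pi>L" "subcumulative C \<alpha>L" "subcumulative C \<pi>U" "subcumulative C \<alpha>U"
    and le: "\<And>i. i \<in> {1..C-1} \<Longrightarrow> \<pi>L i \<le> \<pi>U i \<and> \<alpha>L i \<le> \<alpha>U i"
  shows "is_maximum (ks_values C \<pi>L \<pi>U \<alpha>L \<alpha>U) (MAX i\<in>{1..C-1}. d i)"
proof -
  define M where "M = (MAX i\<in>{1..C-1}. d i)"
  have d_le: "d i \<le> M" if "i \<in> {1..C-1}" for i
    unfolding M_def using that by (intro Max_ge) auto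
  have ks_le: "x \<le> M" if x: "x \<in> ks_values C \<pi>L \<pi>U \<alpha>L \<alpha>U" for x
  proof -
    obtain f g where fg: "x = ks_dist C f g" "within_bounds C \<pi>L \<pi>U f" "within_bounds C \<alpha>L \<alpha>U g"
      using x by (auto simp: ks_values_def)
    have "\<bar>f i - g i\<bar> \<le> M" if i: "i \<in> {1..C-1}" for i
    proof -
      have "\<pi>L i \<le> f i" "f i \<le> \<pi>U i" "\<alpha>L i \<le> g i" "g i \<le> \<alpha>U i"
        using fg i by (auto simp: within_bounds_def)
      then show ?thesis
        using d_le[OF i] by (simp add: d_def abs_le_iff)
    qed
    then show ?thesis
      using fg C by (simp add: ks_dist_le_iff)
  qed
  have "M \<in> d ` {1..C-1}"
    unfolding M_def using C by (intro Max_in) auto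
  then obtain k where k: "k \<in> {1..C-1}" "M = d k"
    by blast
  have within: "within_bounds C \<pi>L \<pi>U \<pi>L" "within_bounds C \<pi>L \<pi>U \<pi>U"
    "within_bounds C \<alpha>L \<alpha>U \<alpha>L" "within_bounds C \<alpha>L \<alpha>U \<alpha>U"
    using le by (auto simp: within_bounds_def)
  have mem: "ks_dist C \<pi>U \<alpha>L \<in> ks_values C \<pi>L \<pi>U \<alpha>L \<alpha>U"
    "ks_dist C \<pi>L \<alpha>U \<in> ks_values C \<pi>L \<pi>U \<alpha>L \<alpha>U"
    using C sub within by (auto intro: ks_values_subcumulative)
  \<comment> \<open>Whichever term of \<open>d k\<close> is larger at the maximizing index
    \<open>k\<close> decides which pair of envelopes is used.\<close>
  have "M \<le> ks_dist C \<pi>U \<alpha>L \<or> M \<le> ks_dist C \<pi>L \<alpha>U"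
    using abs_diff_le_ks_dist[OF k(1), of \<pi>U \<alpha>L] abs_diff_le_ks_dist[OF k(1), of \<pi>L \<alpha>U] k(2)
    by (auto simp: d_def)
  then have "M \<in> ks_values C \<pi>L \<pi>U \<alpha>L \<alpha>U"
    using mem ks_le by (metis order_antisym)
  then show ?thesis
    using ks_le by (simp add: is_maximum_def M_def)
qed

theorem proposition5:
  fixes C :: nat and P_empty P_N :: "nat pmf" and \<epsilon> :: real
    and \<pi>L \<pi>U \<alpha>L \<alpha>U :: "nat \<Rightarrow> real"
  assumes "C \<ge> 2" and "0 \<le> \<epsilon>" and "\<epsilon> \<le> 1"
    and "dist_on C P_empty" and "dist_on C P_N"
    and "\<pi>L = cum_lower \<epsilon> P_empty" and "\<pi>U = cum_upper \<epsilon> P_empty"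
    and "\<alpha>L = cum_lower \<epsilon> P_N" and "\<alpha>U = cum_upper \<epsilon> P_N"
  shows "is_minimum (ks_values C \<pi>L \<pi>U \<alpha>L \<alpha>U) (D_lower C \<pi>L \<pi>U \<alpha>L \<alpha>U) \<and>
    is_minimum (lp_values C \<pi>L \<pi>U \<alpha>L \<alpha>U) (D_lower C \<pi>L \<pi>U \<alpha>L \<alpha>U) \<and>
    is_maximum (ks_values C \<pi>L \<pi>U \<alpha>L \<alpha>U) (D_upper C \<pi>L \<pi>U \<alpha>L \<alpha>U) \<and>
    D_upper C \<pi>L \<pi>U \<alpha>L \<alpha>U =
      (MAX k\<in>{1..C-1}. max (\<pi>U k - \<alpha>L k) (\<alpha>U k - \<pi>L k))"
proof -
  have sub: "subcumulative C \<pi>L" "subcumulative C \<alpha>L" "subcumulative C \<pi>U" "subcumulative C \<alpha>U"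
    using assms by (simp_all add: subcumulative_cum_lower subcumulative_cum_upper)
  have le: "\<pi>L i \<le> \<pi>U i \<and> \<alpha>L i \<le> \<alpha>U i" for i
    using assms by (simp add: cum_upper_def)
  note min = is_minimum_lower_bound[OF assms(1) sub(1,2) le]
  note max = is_maximum_upper_bound[OF assms(1) sub le]
  \<comment> \<open>Both minima have the same closed form, so the infimum over cumulative
    distributions is also the attained optimum of the linear program.\<close>
  show ?thesis
    using min max is_minimum_Inf[OF min(1)] is_maximum_Sup[OF max]
    by (simp add: D_lower_def D_upper_def)
qed

end
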